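(* Let $\beta^-,\beta^+>0$, $0<h<1$, and let $K=\square A_1A_2A_3A_4$ with $A_1=(0,0)$, $A_2=(h,0)$, $A_3=(0,h)$, $A_4=(h,h)$ be a rectangular interface element (of Type I or Type II), let $B$ be an edge of $K$, and let $\mathbf n_B$ be a unit normal to $B$. There exists a constant $C$ independent of the interface location such that for every bilinear IFE function $v(x,y)$ on $K$ the following inequalities hold: $$\|\beta v_p\|_{L^2(B)}\le C h^{1/2}|K|^{-1/2}\|\sqrt{\beta}\,\nabla v\|_{L^2(K)},\qquad p=x,y,$$ $$\|\beta\nabla v\cdot\mathbf n_B\|_{L^2(B)}\le C h^{1/2}|K|^{-1/2}\|\sqrt{\beta}\,\nabla v\|_{L^2(K)}.$$
   Context: The interface $\Gamma$ is a curve separating the domain $\Omega\subset\mathbb{R}^2$ into $\Omega^-$ and $\Omega^+$, and $\beta=\beta^-$ on $\Omega^-$, $\beta=\beta^+$ on $\Omega^+$. $K$ is an interface element: $\Gamma$ intersects $\partial K$ at points $D\neq E$, and the line $\overline{DE}$ separates $K$ into two subelements $K^-$ and $K^+$ (corresponding to the $\Omega^-$ and $\Omega^+$ sides). $K$ is of Type I if $D=(0,dh)$, $E=(eh,0)$, and of Type II if $D=(dh,h)$, $E=(eh,0)$, with $0\le d\le1$, $0\le e\le1$. A bilinear IFE (immersed finite element) function on $K$ is a function with $v=v^-=c_1^-+c_2^-x+c_3^-y+c_4xy$ on $K^-$ and $v=v^+=c_1^++c_2^+x+c_3^+y+c_4xy$ on $K^+$ (same coefficient $c_4$) satisfying $$v^-(D)=v^+(D),\qquad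 v^-(E)=v^+(E),\qquad \int_{\overline{DE}}\Big(\beta^-\frac{\partial v^-}{\partial\mathbf n_{\overline{DE}}}-\beta^+\frac{\partial v^+}{\partial\mathbf n_{\overline{DE}}}\Big)ds=0,$$ where $\mathbf n_{\overline{DE}}$ is a unit normal to $\overline{DE}$. Such $v$ is continuous on $K$; $v_x,v_y,\nabla v$ denote its piecewise derivatives, and $\|\cdot\|_{L^2(B)}$ is taken of the piecewise-defined trace from $K$. $|K|$ is the area of $K$. "Independent of the interface location" means independent of how $\Gamma$ cuts $K$ (the positions of $D,E$). The constant may depend on $\beta^\pm$ but not on $h$. *)

theory Defs
  imports "HOL-Analysis.Analysis"
begin

type_synonym point = "real \<times> real"

definition segment_integral :: "point \<Rightarrow> point \<Rightarrow> (point \<Rightarrow> real) \<Rightarrow> real" where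
  "segment_integral a b f = dist a b * (LINT t:{0..1}|lborel. f (linepath a b t))"

definition L2_segment :: "point \<Rightarrow> point \<Rightarrow> (point \<Rightarrow> 'a::real_normed_vector) \<Rightarrow> real" where
  "L2_segment a b f = sqrt (segment_integral a b (\<lambda>p. (norm (f p))\<^sup>2))"

definition L2_region :: "point set \<Rightarrow> (point \<Rightarrow> 'a::real_normed_vector) \<Rightarrow> real" where
  "L2_region S f = sqrt (LINT p:S|lborel. (norm (f p))\<^sup>2)"

definition unit_normal :: "point \<Rightarrow> point \<Rightarrow> point \<Rightarrow> bool" where
  "unit_normal a b n \<longleftrightarrow> norm n = 1 \<and> n \<bullet> (b - a) = 0"

definition partial_x :: "(point \<Rightarrow> real) \<Rightarrow> point \<Rightarrow> real" where
  "partial_x f p = deriv (\<lambda>t. f (t, snd p)) (fst p)"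

definition partial_y :: "(point \<Rightarrow> real) \<Rightarrow> point \<Rightarrow> real" where
  "partial_y f p = deriv (\<lambda>t. f (fst p, t)) (snd p)"

definition gradient :: "(point \<Rightarrow> real) \<Rightarrow> point \<Rightarrow> point" where
  "gradient f p = (partial_x f p, partial_y f p)"

definition element :: "real \<Rightarrow> point set" where
  "element h = {0..h} \<times> {0..h}"

definition edges :: "real \<Rightarrow> (point \<times> point) set" where
  "edges h = {((0, 0), (h, 0)), ((0, 0), (0, h)), ((h, 0), (h, h)), ((0, h), (h, h))}"

text \<open>A curve is a continuous image of an interval; closed curves, arcs and unbounded curves are
  all covered, and no smoothness is imposed. Likewise the two parts of the domain need not be
  connected.\<close>

definition curve :: "point set \<Rightarrow> bool" where
  "curve \<Gamma> \<longleftrightarrow>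
     (\<exists>(\<gamma> :: real \<Rightarrow> point) I. is_interval I \<and> continuous_on I \<gamma> \<and> \<Gamma> = \<gamma> ` I)"

definition separates :: "point set \<Rightarrow> point set \<Rightarrow> point set \<Rightarrow> point set \<Rightarrow> bool" where
  "separates \<Gamma> \<Omega> \<Omega>m \<Omega>p \<longleftrightarrow>
     open \<Omega> \<and> connected \<Omega> \<and> curve \<Gamma> \<and>
     open \<Omega>m \<and> open \<Omega>p \<and> \<Omega>m \<noteq> {} \<and> \<Omega>p \<noteq> {} \<and> \<Omega>m \<inter> \<Omega>p = {} \<and> \<Omega> - \<Gamma> = \<Omega>m \<union> \<Omega>p"

definition type_I :: "real \<Rightarrow> point \<Rightarrow> point \<Rightarrow> bool" where
  "type_I h D E \<longleftrightarrow> (\<exists>d\<in>{0..1}. \<exists>e\<in>{0..1}. D = (0, d * h) \<and> E = (e * h, 0))"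

definition type_II :: "real \<Rightarrow> point \<Rightarrow> point \<Rightarrow> bool" where
  "type_II h D E \<longleftrightarrow> (\<exists>d\<in>{0..1}. \<exists>e\<in>{0..1}. D = (d * h, h) \<and> E = (e * h, 0))"

text \<open>The unit normal \<open>n\<close> of the line \<open>DE\<close> is oriented from \<open>K\<^sup>-\<close> to \<open>K\<^sup>+\<close>; since \<open>n\<close> may be either of
  the two unit normals, either side of the line can be the minus side. The last two conjuncts say
  that the two sides of the line correspond to \<open>\<Omega>\<^sup>-\<close> and \<open>\<Omega>\<^sup>+\<close>. Edges of \<open>K\<close> may lie on the
  boundary of \<open>\<Omega>\<close>, so this is expressed by closures taken from inside \<open>K\<close>.\<close>

definition interface_element ::
  "real \<Rightarrow> point set \<Rightarrow> point set \<Rightarrow> point set \<Rightarrow> point set \<Rightarrow> point \<Rightarrow> point \<Rightarrow> point \<Rightarrow> bool" where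
  "interface_element h \<Gamma> \<Omega> \<Omega>m \<Omega>p D E n \<longleftrightarrow>
     separates \<Gamma> \<Omega> \<Omega>m \<Omega>p \<and> interior (element h) \<subseteq> \<Omega> \<and>
     (type_I h D E \<or> type_II h D E) \<and> D \<noteq> E \<and> \<Gamma> \<inter> frontier (element h) = {D, E} \<and>
     unit_normal D E n \<and>
     (\<forall>p\<in>frontier (element h). (p - D) \<bullet> n < 0 \<longrightarrow> p \<in> closure (\<Omega>m \<inter> interior (element h))) \<and>
     (\<forall>p\<in>frontier (element h). (p - D) \<bullet> n > 0 \<longrightarrow> p \<in> closure (\<Omega>p \<inter> interior (element h)))"

text \<open>The coefficient on \<open>K\<close>, split by the curve and not by the line \<open>DE\<close>. The closure extends it to
  the edges of \<open>K\<close> by its trace from inside \<open>K\<close>; at points of the curve the value is immaterial.\<close>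

definition coefficient :: "real \<Rightarrow> point set \<Rightarrow> real \<Rightarrow> real \<Rightarrow> point \<Rightarrow> real" where
  "coefficient h \<Omega>m \<beta>m \<beta>p p =
     (if p \<in> closure (\<Omega>m \<inter> interior (element h)) then \<beta>m else \<beta>p)"

text \<open>\<open>K\<^sup>-\<close> is the closure of an open piece so that it is empty when \<open>DE\<close> is an edge of \<open>K\<close> and \<open>K\<close>
  lies on the plus side; traces on that edge are then those of the plus piece, as they should be.\<close>

definition minus_subelement :: "real \<Rightarrow> point \<Rightarrow> point \<Rightarrow> point set" where
  "minus_subelement h D n = closure {p \<in> interior (element h). (p - D) \<bullet> n < 0}"

definition piecewise ::
  "real \<Rightarrow> point \<Rightarrow> point \<Rightarrow> (point \<Rightarrow> 'a) \<Rightarrow> (point \<Rightarrow> 'a) \<Rightarrow> point \<Rightarrow> 'a" where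
  "piecewise h D n fm fp p = (if p \<in> minus_subelement h D n then fm p else fp p)"

text \<open>A bilinear IFE function is given by its two pieces \<open>v\<^sup>-\<close> and \<open>v\<^sup>+\<close>, the function on \<open>K\<close> being
  \<open>piecewise h D n v\<^sup>- v\<^sup>+\<close>.\<close>

definition bilinear_ife ::
  "real \<Rightarrow> real \<Rightarrow> point \<Rightarrow> point \<Rightarrow> point \<Rightarrow> (point \<Rightarrow> real) \<Rightarrow> (point \<Rightarrow> real) \<Rightarrow> bool" where
  "bilinear_ife \<beta>m \<beta>p D E n vm vp \<longleftrightarrow>
     (\<exists>c1m c2m c3m c1p c2p c3p c4.
        vm = (\<lambda>(x, y). c1m + c2m * x + c3m * y + c4 * x * y) \<and>
        vp = (\<lambda>(x, y). c1p + c2p * x + c3p * y + c4 * x * y)) \<and>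
     vm D = vp D \<and> vm E = vp E \<and>
     segment_integral D E (\<lambda>p. \<beta>m * (gradient vm p \<bullet> n) - \<beta>p * (gradient vp p \<bullet> n)) = 0"

end

theory Submission
  imports Defs
begin

text \<open>On a square of side \<open>h\<close> the estimate is an inverse inequality, and the only danger is that one
  of the two subelements may be arbitrarily thin. Two observations remove it.

  Whichever way the line \<open>DE\<close> runs, one of its open sides contains one of the four quarter squares
  of \<open>K\<close> (lemma \<open>quarter_in_half_plane\<close>). On that quarter the piecewise gradient is
  the gradient \<open>g\<close> of a single bilinear polynomial, and an exact evaluation of its \<open>L\<^sup>2\<close>
  norm over the quarter shows that \<open>g\<close> is bounded on all of \<open>K\<close> by a multiple of \<open>1/h\<close> times that
  norm (lemma \<open>norm_bilinear_gradient_le_L2\<close>).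

  The other polynomial is then controlled through the interface conditions. As the two pieces share
  their \<open>xy\<close> coefficient, they differ by an affine function, which vanishes on the line \<open>DE\<close>; hence
  their gradients differ by a constant multiple \<open>w\<close> of the normal. The flux integrand is affine along
  \<open>DE\<close>, so that the flux condition is a condition at the midpoint of \<open>DE\<close>, and it bounds \<open>w\<close> by
  either of the two gradients at that point, with the contrast of the coefficients as
  factor (lemma \<open>gradient_jump_bound\<close>).

  So both gradient polynomials are bounded on all of \<open>K\<close> by the energy, with a constant that depends
  on \<open>\<beta>\<^sup>-\<close> and \<open>\<beta>\<^sup>+\<close> only (lemma \<open>gradients_bounded_by_energy\<close>), and an edge of length \<open>h\<close>
  contributes the factor \<open>sqrt h\<close>. That the coefficient jumps across the curve and the gradient across
  the line is harmless, because only upper and lower bounds of the coefficient enter.\<close>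

section \<open>Gradients of bilinear polynomials\<close>

lemma gradient_bilinear:
  fixes c1 c2 c3 c4 :: real
  shows "gradient (\<lambda>(x, y). c1 + c2 * x + c3 * y + c4 * x * y)
    = (\<lambda>p. (c2 + c4 * snd p, c3 + c4 * fst p))"
proof
  fix p :: point
  have "((\<lambda>t. c1 + c2 * t + c3 * snd p + c4 * t * snd p)
          has_real_derivative c2 + c4 * snd p) (at (fst p))"
    by (auto intro!: derivative_eq_intros)
  moreover have "((\<lambda>t. c1 + c2 * fst p + c3 * t + c4 * fst p * t)
          has_real_derivative c3 + c4 * fst p) (at (snd p))"
    by (auto intro!: derivative_eq_intros)
  ultimately show "gradient (\<lambda>(x, y). c1 + c2 * x + c3 * y + c4 * x * y) p
      = (c2 + c4 * snd p, c3 + c4 * fst p)"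
    by (simp add: gradient_def partial_x_def partial_y_def DERIV_imp_deriv)
qed

text \<open>Gradients of bilinear functions differ at two points by \<open>c4\<close> times the reflected displacement,
  and reflection is an isometry.\<close>

lemma bilinear_gradient_Lipschitz:
  fixes p q :: point and c2 c3 c4 :: real
  shows "dist (c2 + c4 * snd p, c3 + c4 * fst p) (c2 + c4 * snd q, c3 + c4 * fst q)
    = \<bar>c4\<bar> * dist p q"
proof -
  have "(c4 * snd p - c4 * snd q)\<^sup>2 + (c4 * fst p - c4 * fst q)\<^sup>2
      = c4\<^sup>2 * ((fst p - fst q)\<^sup>2 + (snd p - snd q)\<^sup>2)"
    by (simp add: power2_eq_square algebra_simps)
  then show ?thesis
    by (simp add: dist_prod_def dist_real_def real_sqrt_mult)
qed

lemma set_integral_affine: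
  fixes \<alpha> \<gamma> :: real
  shows "(LINT t:{0..1}|lborel. \<alpha> + \<gamma> * t) = \<alpha> + \<gamma> / 2"
proof -
  have "((\<lambda>t. \<alpha> + \<gamma> * t) has_integral (\<alpha> * 1 + \<gamma> * 1\<^sup>2 / 2) - (\<alpha> * 0 + \<gamma> * 0\<^sup>2 / 2)) {0..1}"
    by (rule fundamental_theorem_of_calculus)
       (auto intro!: derivative_eq_intros simp: has_real_derivative_iff_has_vector_derivative [symmetric])
  moreover have "set_integrable lborel {0..1} (\<lambda>t. \<alpha> + \<gamma> * t)"
    by (intro borel_integrable_atLeastAtMost') (auto intro!: continuous_intros)
  ultimately show ?thesis
    by (simp add: set_borel_integral_eq_integral integral_unique)
qed

section \<open>Comparison of norms\<close>

text \<open>The bound includes traces that are not square integrable: their integral is \<open>0\<close> by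
  convention.\<close>

lemma L2_segment_le:
  assumes "\<And>p. p \<in> closed_segment a b \<Longrightarrow> norm (f p) \<le> B"
  shows "L2_segment a b f \<le> sqrt (dist a b) * B"
proof -
  have B: "0 \<le> B" using assms[of a] norm_ge_zero order_trans by blast
  have "(LINT t:{0..1}|lborel. (norm (f (linepath a b t)))\<^sup>2) \<le> (LINT t:{0..1::real}|lborel. B\<^sup>2)"
    unfolding set_lebesgue_integral_def
  proof (rule integral_mono')
    show "integrable lborel (\<lambda>t. indicator {0..1::real} t *\<^sub>R B\<^sup>2)" by simp
    fix t :: real
    have "norm (f (linepath a b t)) \<le> B" if "t \<in> {0..1}"
      using that by (intro assms linepath_in_path)
    then show "indicator {0..1} t *\<^sub>R (norm (f (linepath a b t)))\<^sup>2 \<le> indicator {0..1} t *\<^sub>R B\<^sup>2"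
      by (auto simp: indicator_def intro!: power_mono)
  qed auto
  also have "\<dots> = B\<^sup>2" using set_integral_affine [of "B\<^sup>2" 0] by simp
  finally have "segment_integral a b (\<lambda>p. (norm (f p))\<^sup>2) \<le> dist a b * B\<^sup>2"
    unfolding segment_integral_def by (intro mult_left_mono) auto
  then have "L2_segment a b f \<le> sqrt (dist a b * B\<^sup>2)"
    unfolding L2_segment_def by (rule real_sqrt_le_mono)
  then show ?thesis using B by (simp add: real_sqrt_mult)
qed

lemma L2_region_mono:
  assumes "set_integrable lborel K (\<lambda>p. (norm (f p))\<^sup>2)" and "S \<subseteq> K" and "0 \<le> k"
    and "\<And>p. p \<in> S \<Longrightarrow> k * norm (g p) \<le> norm (f p)"
  shows "k * L2_region S g \<le> L2_region K f"
proof -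
  have "k\<^sup>2 * (LINT p:S|lborel. (norm (g p))\<^sup>2) = (LINT p:S|lborel. (k * norm (g p))\<^sup>2)"
    by (simp add: power_mult_distrib)
  also have "\<dots> \<le> (LINT p:K|lborel. (norm (f p))\<^sup>2)"
    unfolding set_lebesgue_integral_def
  proof (rule integral_mono')
    show "integrable lborel (\<lambda>p. indicator K p *\<^sub>R (norm (f p))\<^sup>2)"
      using assms(1) by (simp add: set_integrable_def)
    fix p
    have "(k * norm (g p))\<^sup>2 \<le> (norm (f p))\<^sup>2" if "p \<in> S"
      using that assms(3,4) by (intro power_mono) auto
    then show "indicator S p *\<^sub>R (k * norm (g p))\<^sup>2 \<le> indicator K p *\<^sub>R (norm (f p))\<^sup>2"
      using assms(2) by (auto simp: indicator_def)
  qed auto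
  finally have "sqrt (k\<^sup>2 * (LINT p:S|lborel. (norm (g p))\<^sup>2)) \<le> L2_region K f"
    unfolding L2_region_def by (rule real_sqrt_le_mono)
  then show ?thesis
    using assms(3) by (simp add: L2_region_def real_sqrt_mult)
qed

section \<open>The inverse estimate on a quarter of the element\<close>

lemma integral_affine_square:
  fixes \<alpha> \<gamma> u l :: real
  assumes "0 \<le> l"
  shows "integral {u..u + l} (\<lambda>t. (\<alpha> + \<gamma> * t)\<^sup>2) = l * ((\<alpha> + \<gamma> * (u + l/2))\<^sup>2 + \<gamma>\<^sup>2 * l\<^sup>2 / 12)"
proof -
  let ?F = "\<lambda>t. \<alpha>\<^sup>2 * t + \<alpha> * \<gamma> * t\<^sup>2 + \<gamma>\<^sup>2 * t^3 / 3"
  have "((\<lambda>t. (\<alpha> + \<gamma> * t)\<^sup>2) has_integral ?F (u + l) - ?F u) {u..u + l}"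
    by (rule fundamental_theorem_of_calculus)
       (use assms in \<open>auto intro!: derivative_eq_intros
          simp: has_real_derivative_iff_has_vector_derivative [symmetric] power2_eq_square algebra_simps\<close>)
  moreover have "?F (u + l) - ?F u = l * ((\<alpha> + \<gamma> * (u + l/2))\<^sup>2 + \<gamma>\<^sup>2 * l\<^sup>2 / 12)"
    by (simp add: power2_eq_square power3_eq_cube field_simps)
  ultimately show ?thesis by (simp add: integral_unique)
qed

text \<open>Each component of the gradient is affine in one variable, so its mean square over a square of
  side \<open>l\<close> is the square of its value at the centre plus the variance \<open>c4\<^sup>2 l\<^sup>2 / 12\<close>.\<close>

lemma L2_bilinear_gradient_square:
  fixes x0 y0 l c2 c3 c4 :: real
  defines "g \<equiv> \<lambda>p::point. (c2 + c4 * snd p, c3 + c4 * fst p)"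
  assumes "0 \<le> l"
  shows "(L2_region (box (x0, y0) (x0 + l, y0 + l)) g)\<^sup>2
    = l\<^sup>2 * ((norm (g (x0 + l/2, y0 + l/2)))\<^sup>2 + c4\<^sup>2 * l\<^sup>2 / 6)"
proof -
  let ?B = "box (x0, y0) (x0 + l, y0 + l)" and ?C = "cbox (x0, y0) (x0 + l, y0 + l)"
  let ?f = "\<lambda>p. (norm (g p))\<^sup>2"
  have f: "?f p = (c2 + c4 * snd p)\<^sup>2 + (c3 + c4 * fst p)\<^sup>2" for p
    by (simp add: g_def norm_prod_def)
  have cont: "continuous_on ?C ?f"
    unfolding f by (intro continuous_intros)
  have "set_integrable lborel ?C ?f"
    unfolding set_integrable_def by (intro borel_integrable_compact compact_cbox cont)
  then have int: "set_integrable lborel ?B ?f"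
    by (rule set_integrable_subset) (auto simp: box_subset_cbox)
  have "(LINT p:?B|lborel. ?f p) = integral ?B ?f"
    using int by (rule set_borel_integral_eq_integral)
  also have "\<dots> = integral ?C ?f"
    by (rule integral_open_interval)
  also have "\<dots> = integral {x0..x0 + l} (\<lambda>x. integral {y0..y0 + l} (\<lambda>y. ?f (x, y)))"
    using integral_prod_continuous [OF cont] by simp
  also have "\<dots> = integral {x0..x0 + l} (\<lambda>x. l * ((c2 + c4 * (y0 + l/2))\<^sup>2 + c4\<^sup>2 * l\<^sup>2 / 12)
      + l * (c3 + c4 * x)\<^sup>2)"
  proof (rule arg_cong2 [where f = integral], simp, rule ext)
    fix x
    have "integral {y0..y0 + l} (\<lambda>y. ?f (x, y))
        = integral {y0..y0 + l} (\<lambda>y. (c2 + c4 * y)\<^sup>2) + integral {y0..y0 + l} (\<lambda>y. (c3 + c4 * x)\<^sup>2)"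
      unfolding f fst_conv snd_conv
      by (intro integral_add integrable_continuous_interval continuous_intros)
    then show "integral {y0..y0 + l} (\<lambda>y. ?f (x, y))
        = l * ((c2 + c4 * (y0 + l/2))\<^sup>2 + c4\<^sup>2 * l\<^sup>2 / 12) + l * (c3 + c4 * x)\<^sup>2"
      using assms by (simp add: integral_affine_square)
  qed
  also have "\<dots> = l * (l * ((c2 + c4 * (y0 + l/2))\<^sup>2 + c4\<^sup>2 * l\<^sup>2 / 12))
      + l * (l * ((c3 + c4 * (x0 + l/2))\<^sup>2 + c4\<^sup>2 * l\<^sup>2 / 12))"
    using assms by (subst integral_add)
      (auto intro!: integrable_continuous_interval continuous_intros simp: integral_affine_square)
  also have "\<dots> = l\<^sup>2 * (?f (x0 + l/2, y0 + l/2) + c4\<^sup>2 * l\<^sup>2 / 6)"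
    unfolding f fst_conv snd_conv by (simp add: power2_eq_square algebra_simps)
  finally show ?thesis
    unfolding L2_region_def by (simp add: real_sqrt_pow2)
qed

text \<open>The exact integral controls both the gradient at the centre of the quarter and its slope
  \<open>c4\<close>; every point of the large square is within distance \<open>2h\<close> of that centre, so the gradient can be
  extrapolated from the quarter to the whole square.\<close>

lemma norm_bilinear_gradient_le_L2:
  fixes x0 y0 h c2 c3 c4 :: real and p :: point
  defines "g \<equiv> \<lambda>p::point. (c2 + c4 * snd p, c3 + c4 * fst p)"
  assumes h: "0 < h" and x0: "x0 \<in> {0, h/2}" and y0: "y0 \<in> {0, h/2}" and p: "p \<in> element h"
  shows "norm (g p) \<le> 22 / h * L2_region (box (x0, y0) (x0 + h/2, y0 + h/2)) g"
proof -
  let ?q = "(x0 + h/2/2, y0 + h/2/2)"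
  \<comment> \<open>\<open>T\<close> is the root mean square of \<open>g\<close> over the quarter, whose area is \<open>h\<^sup>2 / 4\<close>. The factor \<open>22\<close>
    comes from \<open>|g| \<le> T\<close> at the centre and a variation of at most \<open>5 T / h\<close> times \<open>2 h\<close>.\<close>
  define T where "T = 2 / h * L2_region (box (x0, y0) (x0 + h/2, y0 + h/2)) g"
  have "T\<^sup>2 = 4 / h\<^sup>2 * (L2_region (box (x0, y0) (x0 + h/2, y0 + h/2)) g)\<^sup>2"
    by (simp add: T_def power_mult_distrib power_divide)
  also have "\<dots> = (norm (g ?q))\<^sup>2 + c4\<^sup>2 * h\<^sup>2 / 24"
    using h unfolding g_def by (subst L2_bilinear_gradient_square) (auto simp: power_divide)
  finally have T: "T\<^sup>2 = (norm (g ?q))\<^sup>2 + (c4 * h)\<^sup>2 / 24" by (simp add: power_mult_distrib)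
  have [simp]: "0 \<le> T"
  proof -
    have "0 \<le> L2_region S g" for S
      by (simp add: L2_region_def set_lebesgue_integral_def)
    then show ?thesis using h by (simp add: T_def)
  qed
  have "(norm (g ?q))\<^sup>2 \<le> T\<^sup>2" using T by simp
  then have 1: "norm (g ?q) \<le> T" by (rule power2_le_imp_le) simp
  have "(\<bar>c4\<bar> * h)\<^sup>2 \<le> 25 * T\<^sup>2"
    using T zero_le_power2 [of "norm (g ?q)"] zero_le_power2 [of "c4 * h"]
    unfolding power_mult_distrib power2_abs by linarith
  then have "(\<bar>c4\<bar> * h)\<^sup>2 \<le> (5 * T)\<^sup>2" by (simp add: power_mult_distrib)
  then have 2: "\<bar>c4\<bar> * h \<le> 5 * T" by (rule power2_le_imp_le) simp
  have "dist p ?q \<le> \<bar>fst p - fst ?q\<bar> + \<bar>snd p - snd ?q\<bar>"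
    using sqrt_sum_squares_le_sum_abs [of "fst p - fst ?q" "snd p - snd ?q"]
    by (simp add: dist_prod_def dist_real_def)
  also have "\<dots> \<le> 2 * h"
  proof -
    have "\<bar>fst p - fst ?q\<bar> \<le> h" "\<bar>snd p - snd ?q\<bar> \<le> h"
      using p x0 y0 h by (auto simp: element_def abs_le_iff)
    then show ?thesis by linarith
  qed
  finally have "\<bar>c4\<bar> * dist p ?q \<le> \<bar>c4\<bar> * (2 * h)"
    by (rule mult_left_mono) simp
  then have "dist (g p) (g ?q) \<le> 10 * T"
    using 2 unfolding g_def bilinear_gradient_Lipschitz by simp
  then have "norm (g p) \<le> 11 * T"
    using 1 norm_triangle_sub [of "g p" "g ?q"] by (simp add: dist_norm)
  then show ?thesis by (simp add: T_def)
qed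

text \<open>A half plane that contains the centre of the square contains the whole quadrant, seen from the
  centre, into which its inner normal points.\<close>

lemma quarter_in_half_plane:
  fixes h :: real and D n :: point
  assumes "n \<noteq> 0" "0 \<le> ((h/2, h/2) - D) \<bullet> n"
  obtains x0 y0 where "x0 \<in> {0, h/2}" "y0 \<in> {0, h/2}"
    "\<forall>p\<in>box (x0, y0) (x0 + h/2, y0 + h/2). 0 < (p - D) \<bullet> n"
proof
  let ?x = "if 0 \<le> fst n then h/2 else 0" and ?y = "if 0 \<le> snd n then h/2 else 0"
  show "?x \<in> {0, h/2}" "?y \<in> {0, h/2}" by auto
  show "\<forall>p\<in>box (?x, ?y) (?x + h/2, ?y + h/2). 0 < (p - D) \<bullet> n"
  proof
    fix p assume "p \<in> box (?x, ?y) (?x + h/2, ?y + h/2)"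
    then have p: "?x < fst p" "fst p < ?x + h/2" "?y < snd p" "snd p < ?y + h/2"
      by (auto simp: box_prod mem_Times_iff)
    have x: "0 \<le> (fst p - h/2) * fst n" "fst n \<noteq> 0 \<Longrightarrow> 0 < (fst p - h/2) * fst n"
      using p(1,2) by (auto simp: zero_le_mult_iff zero_less_mult_iff split: if_splits)
    have y: "0 \<le> (snd p - h/2) * snd n" "snd n \<noteq> 0 \<Longrightarrow> 0 < (snd p - h/2) * snd n"
      using p(3,4) by (auto simp: zero_le_mult_iff zero_less_mult_iff split: if_splits)
    have "0 < (fst p - h/2) * fst n + (snd p - h/2) * snd n"
      using x y assms(1) by (cases "fst n = 0"; cases "snd n = 0") (auto simp: prod_eq_iff)
    moreover have "(p - D) \<bullet> n = ((h/2, h/2) - D) \<bullet> n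
        + ((fst p - h/2) * fst n + (snd p - h/2) * snd n)"
      by (simp add: inner_prod_def algebra_simps)
    ultimately show "0 < (p - D) \<bullet> n" using assms(2) by linarith
  qed
qed

section \<open>The jump of the gradient across the interface\<close>

lemma orthogonal_imp_multiple_of_unit_normal:
  fixes w n t :: point
  assumes "norm n = 1" "n \<bullet> t = 0" "w \<bullet> t = 0" "t \<noteq> 0"
  shows "w = (w \<bullet> n) *\<^sub>R n"
proof -
  obtain w1 w2 n1 n2 t1 t2 where [simp]: "w = (w1, w2)" "n = (n1, n2)" "t = (t1, t2)"
    by (metis prod.exhaust)
  have n: "n1\<^sup>2 + n2\<^sup>2 = 1"
    using assms(1) by (simp add: norm_prod_def)
  have "t1 * (w1 * n2 - w2 * n1) = 0" "t2 * (w1 * n2 - w2 * n1) = 0"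
    using assms(2,3) by (simp_all, algebra+)
  then have "w1 * n2 = w2 * n1"
    using assms(4) by (auto simp: zero_prod_def)
  then have "w1 = (w1 * n1 + w2 * n2) * n1" "w2 = (w1 * n1 + w2 * n2) * n2"
    using n by algebra+
  then show ?thesis by simp
qed

text \<open>With \<open>A\<close> and \<open>B\<close> the normal derivatives of the two pieces at the midpoint of \<open>DE\<close>, the flux
  condition reads \<open>\<beta>m A = \<beta>p B\<close>, so that the jump \<open>A - B\<close> is a multiple of either of them. The bound by
  both gradients makes the lemma usable whichever piece is the controlled one.\<close>

lemma gradient_jump_bound:
  assumes ife: "bilinear_ife \<beta>m \<beta>p D E n vm vp" and n: "unit_normal D E n" and DE: "D \<noteq> E"
    and b: "0 < b0" "b0 \<le> \<beta>m" "\<beta>m \<le> b1" "b0 \<le> \<beta>p" "\<beta>p \<le> b1"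
  obtains w where "\<And>p. gradient vm p = gradient vp p + w"
    "norm w \<le> b1 / b0 * norm (gradient vm (midpoint D E))"
    "norm w \<le> b1 / b0 * norm (gradient vp (midpoint D E))"
proof -
  obtain c1m c2m c3m c1p c2p c3p c4 where
    vm: "vm = (\<lambda>(x, y). c1m + c2m * x + c3m * y + c4 * x * y)" and
    vp: "vp = (\<lambda>(x, y). c1p + c2p * x + c3p * y + c4 * x * y)" and
    eq: "vm D = vp D" "vm E = vp E" and
    flux: "segment_integral D E (\<lambda>p. \<beta>m * (gradient vm p \<bullet> n) - \<beta>p * (gradient vp p \<bullet> n)) = 0"
    using ife unfolding bilinear_ife_def by blast
  note g = gradient_bilinear [of c1m c2m c3m c4, folded vm]
    gradient_bilinear [of c1p c2p c3p c4, folded vp]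
  define w where "w = (c2m - c2p, c3m - c3p)"
  let ?M = "midpoint D E"
  have jump: "gradient vm p = gradient vp p + w" for p
    by (simp add: g w_def)
  have "w \<bullet> (E - D) = 0"
    using eq by (cases D, cases E) (simp add: vm vp w_def algebra_simps)
  then have w: "w = (w \<bullet> n) *\<^sub>R n"
    using n DE by (intro orthogonal_imp_multiple_of_unit_normal [where t = "E - D"])
      (auto simp: unit_normal_def)
  have nn: "norm n = 1" using n by (simp add: unit_normal_def)
  have "norm w = norm ((w \<bullet> n) *\<^sub>R n)" using w by simp
  then have norm_w: "norm w = \<bar>w \<bullet> n\<bar>" using nn by simp
  define F where "F = (\<lambda>p. \<beta>m * (gradient vm p \<bullet> n) - \<beta>p * (gradient vp p \<bullet> n))"
  \<comment> \<open>The flux integrand is affine along \<open>DE\<close>, so its mean is its value at the midpoint.\<close>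
  have lin: "F (linepath D E t) = F D + (F E - F D) * t" for t
    by (cases D, cases E, cases n) (simp add: F_def g linepath_def algebra_simps)
  have "F ?M = F D + (F E - F D) / 2"
    using lin [of "1/2"] by (simp add: linepath_def midpoint_def scaleR_add_right)
  moreover have "F D + (F E - F D) / 2 = 0"
    using flux DE set_integral_affine [of "F D" "F E - F D"]
    unfolding F_def [symmetric] segment_integral_def lin by simp
  ultimately have M: "\<beta>m * (gradient vm ?M \<bullet> n) = \<beta>p * (gradient vp ?M \<bullet> n)"
    by (simp add: F_def)
  define A B where "A = gradient vm ?M \<bullet> n" and "B = gradient vp ?M \<bullet> n"
  have AB: "A = B + w \<bullet> n" by (simp add: A_def B_def jump inner_add_left)
  have MB: "\<beta>m * A = \<beta>p * B" using M by (simp add: A_def B_def)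
  have ord: "0 \<le> \<bar>\<beta>p - \<beta>m\<bar>" "\<bar>\<beta>p - \<beta>m\<bar> \<le> b1" using b by auto
  have bound: "\<bar>w \<bullet> n\<bar> \<le> b1 / b0 * \<bar>X\<bar>" if "\<beta> * (w \<bullet> n) = (\<beta>p - \<beta>m) * X" "b0 \<le> \<beta>" for X \<beta>
  proof -
    have "b0 * \<bar>w \<bullet> n\<bar> \<le> \<beta> * \<bar>w \<bullet> n\<bar>" using that by (intro mult_right_mono) auto
    also have "\<dots> = \<bar>\<beta> * (w \<bullet> n)\<bar>" using that(2) b by (simp add: abs_mult)
    also have "\<dots> = \<bar>\<beta>p - \<beta>m\<bar> * \<bar>X\<bar>" by (simp only: that(1) abs_mult)
    also have "\<dots> \<le> b1 * \<bar>X\<bar>" using ord by (intro mult_right_mono) auto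
    finally show ?thesis using b by (simp add: field_simps)
  qed
  have k: "0 \<le> b1 / b0" using b by simp
  have CS: "\<bar>A\<bar> \<le> norm (gradient vm ?M)" "\<bar>B\<bar> \<le> norm (gradient vp ?M)"
    using Cauchy_Schwarz_ineq2 [of _ n] nn unfolding A_def B_def by (metis mult.right_neutral)+
  \<comment> \<open>Eliminating \<open>B\<close>, respectively \<open>A\<close>, from \<open>A = B + w \<bullet> n\<close> with the flux condition.\<close>
  have "\<beta>p * (w \<bullet> n) = (\<beta>p - \<beta>m) * A" "\<beta>m * (w \<bullet> n) = (\<beta>p - \<beta>m) * B"
    using AB MB by algebra+
  then have "\<bar>w \<bullet> n\<bar> \<le> b1 / b0 * \<bar>A\<bar>" "\<bar>w \<bullet> n\<bar> \<le> b1 / b0 * \<bar>B\<bar>"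
    using bound b by blast+
  then have "norm w \<le> b1 / b0 * norm (gradient vm ?M)" "norm w \<le> b1 / b0 * norm (gradient vp ?M)"
    using mult_left_mono [OF CS(1) k] mult_left_mono [OF CS(2) k] norm_w by linarith+
  then show thesis using jump that by blast
qed

section \<open>The energy controls both pieces\<close>

lemma piecewise_plus: "0 < (p - D) \<bullet> n \<Longrightarrow> piecewise h D n fm fp p = fp p"
proof -
  assume p: "0 < (p - D) \<bullet> n"
  have "closed {p. (p - D) \<bullet> n \<le> 0}"
    by (intro closed_Collect_le continuous_intros)
  then have "minus_subelement h D n \<subseteq> {p. (p - D) \<bullet> n \<le> 0}"
    unfolding minus_subelement_def by (intro closure_minimal) auto
  with p show ?thesis by (auto simp: piecewise_def)
qed

lemma piecewise_minus:
  "p \<in> interior (element h) \<Longrightarrow> (p - D) \<bullet> n < 0 \<Longrightarrow> piecewise h D n fm fp p = fm p"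
  using closure_subset [THEN subsetD, of p "{p \<in> interior (element h). (p - D) \<bullet> n < 0}"]
  by (simp add: piecewise_def minus_subelement_def)

lemma element_eq_cbox: "element h = cbox (0, 0) (h, h)"
  by (simp add: element_def cbox_Pair_eq)

lemma quarter_subset_interior:
  assumes "x0 \<in> {0, h/2}" "y0 \<in> {0, h/2}" "0 < h"
  shows "box (x0, y0) (x0 + h/2, y0 + h/2) \<subseteq> interior (element h)"
  unfolding element_eq_cbox interior_cbox using assms by (auto simp: box_prod mem_Times_iff)

text \<open>Integrability of the energy density has to be known before the integral over the quarter can be
  compared with the one over \<open>K\<close>. Both the coefficient and the piecewise gradient switch on closed
  sets, whatever the curve is, so the density is Borel and bounded.\<close>

lemma set_integrable_energy:
  assumes "continuous_on UNIV gm" "continuous_on UNIV gp"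
  shows "set_integrable lborel (element h)
    (\<lambda>p. (norm (sqrt (coefficient h \<Omega>m \<beta>m \<beta>p p) *\<^sub>R piecewise h D n gm gp p :: point))\<^sup>2)"
proof -
  let ?f = "\<lambda>p. (norm (sqrt (coefficient h \<Omega>m \<beta>m \<beta>p p) *\<^sub>R piecewise h D n gm gp p :: point))\<^sup>2"
  have K: "compact (element h)" by (simp add: element_eq_cbox)
  have bdd: "\<exists>B. \<forall>p\<in>element h. norm (g p) \<le> B" if "continuous_on UNIV g" for g :: "point \<Rightarrow> point"
    using compact_imp_bounded [OF compact_continuous_image [OF continuous_on_subset [OF that] K]]
    by (auto simp: bounded_iff)
  obtain Bm Bp where B: "\<And>p. p \<in> element h \<Longrightarrow> norm (gm p) \<le> Bm"
    "\<And>p. p \<in> element h \<Longrightarrow> norm (gp p) \<le> Bp"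
    using bdd assms by meson
  have [measurable]: "gm \<in> borel_measurable borel" "gp \<in> borel_measurable borel"
    using assms by (auto intro: borel_measurable_continuous_onI)
  have [measurable]: "closure S \<in> sets borel" for S :: "point set" by simp
  have [measurable]: "minus_subelement h D n \<in> sets borel" by (simp add: minus_subelement_def)
  have meas: "?f \<in> borel_measurable borel"
    unfolding coefficient_def piecewise_def by measurable
  have le: "norm (?f p) \<le> (max \<bar>sqrt \<beta>m\<bar> \<bar>sqrt \<beta>p\<bar> * max Bm Bp)\<^sup>2" if "p \<in> element h" for p
  proof -
    have "norm (sqrt (coefficient h \<Omega>m \<beta>m \<beta>p p) *\<^sub>R piecewise h D n gm gp p)
        \<le> max \<bar>sqrt \<beta>m\<bar> \<bar>sqrt \<beta>p\<bar> * max Bm Bp"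
      unfolding norm_scaleR
      by (intro mult_mono)
         (use B [OF that] in \<open>auto simp: coefficient_def piecewise_def le_max_iff_disj\<close>)
    then show ?thesis by (simp add: power_mono)
  qed
  have fin: "emeasure lborel (element h) < \<infinity>"
    unfolding element_eq_cbox by (rule emeasure_lborel_cbox_finite)
  show ?thesis
    unfolding set_integrable_def
    using meas le K fin
    by (intro integrableI_bounded_set_indicator [where B = "(max \<bar>sqrt \<beta>m\<bar> \<bar>sqrt \<beta>p\<bar> * max Bm Bp)\<^sup>2"])
       (auto simp: compact_imp_closed)
qed

text \<open>The centre of the element lies on one side of the line, and the quarter square found on that
  side sees only one of the two pieces.\<close>

lemma quarter_of_one_piece:
  fixes gm gp :: "point \<Rightarrow> 'a"
  assumes "0 < h" "n \<noteq> 0"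
  obtains x0 y0 g where "x0 \<in> {0, h/2}" "y0 \<in> {0, h/2}" "g = gm \<or> g = gp"
    "\<forall>p\<in>box (x0, y0) (x0 + h/2, y0 + h/2). piecewise h D n gm gp p = g p"
proof (cases "0 \<le> ((h/2, h/2) - D) \<bullet> n")
  case True
  then show thesis
    by (rule quarter_in_half_plane [OF assms(2)]) (metis that piecewise_plus)
next
  case False
  then have "- n \<noteq> 0" "0 \<le> ((h/2, h/2) - D) \<bullet> (- n)" using assms by auto
  then obtain x0 y0 where xy: "x0 \<in> {0, h/2}" "y0 \<in> {0, h/2}"
    and "\<forall>p\<in>box (x0, y0) (x0 + h/2, y0 + h/2). 0 < (p - D) \<bullet> (- n)"
    by (rule quarter_in_half_plane) blast
  then have "piecewise h D n gm gp p = gm p" if "p \<in> box (x0, y0) (x0 + h/2, y0 + h/2)" for p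
    using that quarter_subset_interior [OF xy assms(1)] by (intro piecewise_minus) fastforce+
  with xy show thesis using that by blast
qed

text \<open>The bounds hold for both polynomials at every point of the element, not only on their own
  subelements. So a trace on an edge is bounded whichever piece it comes from.\<close>

lemma gradients_bounded_by_energy:
  fixes \<Omega>m :: "point set"
  assumes h: "0 < h" and DE: "D \<in> element h" "E \<in> element h" "D \<noteq> E" and n: "unit_normal D E n"
    and ife: "bilinear_ife \<beta>m \<beta>p D E n vm vp"
    and b: "0 < b0" "b0 \<le> \<beta>m" "\<beta>m \<le> b1" "b0 \<le> \<beta>p" "\<beta>p \<le> b1"
    and p: "p \<in> element h"
  defines "T \<equiv> L2_region (element h)
    (\<lambda>p. sqrt (coefficient h \<Omega>m \<beta>m \<beta>p p) *\<^sub>R piecewise h D n (gradient vm) (gradient vp) p)"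
  shows "norm (gradient vm p) \<le> (1 + b1 / b0) * (22 / (h * sqrt b0) * T)"
    and "norm (gradient vp p) \<le> (1 + b1 / b0) * (22 / (h * sqrt b0) * T)"
proof -
  let ?S = "22 / (h * sqrt b0) * T"
  obtain w where w: "\<And>p. gradient vm p = gradient vp p + w"
    "norm w \<le> b1 / b0 * norm (gradient vm (midpoint D E))"
    "norm w \<le> b1 / b0 * norm (gradient vp (midpoint D E))"
    using gradient_jump_bound [OF ife n DE(3) b] by blast
  obtain c1m c2m c3m c1p c2p c3p c4 where
    v: "vm = (\<lambda>(x, y). c1m + c2m * x + c3m * y + c4 * x * y)"
      "vp = (\<lambda>(x, y). c1p + c2p * x + c3p * y + c4 * x * y)"
    using ife unfolding bilinear_ife_def by blast
  have cont: "continuous_on UNIV (gradient vm)" "continuous_on UNIV (gradient vp)"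
    unfolding v gradient_bilinear by (intro continuous_intros)+
  have "n \<noteq> 0" using n by (auto simp: unit_normal_def)
  then obtain x0 y0 g where xy: "x0 \<in> {0, h/2}" "y0 \<in> {0, h/2}"
    and g: "g = gradient vm \<or> g = gradient vp"
    and Q: "\<forall>p\<in>box (x0, y0) (x0 + h/2, y0 + h/2).
      piecewise h D n (gradient vm) (gradient vp) p = g p"
    by (rule quarter_of_one_piece [OF h,
          where gm = "gradient vm" and gp = "gradient vp" and D = D]) blast
  obtain c2 c3 where g': "g = (\<lambda>p. (c2 + c4 * snd p, c3 + c4 * fst p))"
    using g unfolding v gradient_bilinear by blast
  let ?Q = "box (x0, y0) (x0 + h/2, y0 + h/2)"
  have "sqrt b0 * L2_region ?Q g \<le> T"
    unfolding T_def
  proof (rule L2_region_mono [OF set_integrable_energy [OF cont]])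
    show "?Q \<subseteq> element h"
      using quarter_subset_interior [OF xy h] interior_subset by blast
    fix p assume "p \<in> ?Q"
    moreover have "b0 \<le> coefficient h \<Omega>m \<beta>m \<beta>p p" using b by (simp add: coefficient_def)
    ultimately show "sqrt b0 * norm (g p) \<le> norm (sqrt (coefficient h \<Omega>m \<beta>m \<beta>p p) *\<^sub>R
        piecewise h D n (gradient vm) (gradient vp) p)"
      using b by (auto simp: Q intro!: mult_right_mono)
  qed (use b in simp)
  then have "22 / h * L2_region ?Q g \<le> ?S"
    using h b by (simp add: field_simps)
  then have gS: "norm (g q) \<le> ?S" if "q \<in> element h" for q
    using norm_bilinear_gradient_le_L2 [OF h xy that, of c2 c4 c3] unfolding g' by linarith
  have "midpoint D E \<in> element h"
    using DE closed_segment_subset [of D "element h" E] midpoint_in_closed_segment [of D E]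
    by (auto simp: element_eq_cbox)
  then have "norm (g (midpoint D E)) \<le> ?S" by (rule gS)
  then have "b1 / b0 * norm (g (midpoint D E)) \<le> b1 / b0 * ?S"
    using b by (intro mult_left_mono) auto
  then have wS: "norm w \<le> b1 / b0 * ?S" using g w(2,3) by auto
  have "0 \<le> ?S" using gS [OF p] norm_ge_zero order_trans by blast
  then have "0 \<le> b1 / b0 * ?S"
    using b by (intro mult_nonneg_nonneg [of "b1 / b0"]) auto
  moreover have "norm (gradient vm p) \<le> norm (g p) + norm w \<or> g = gradient vm"
    "norm (gradient vp p) \<le> norm (g p) + norm w \<or> g = gradient vp"
    using g w(1) [of p] norm_triangle_ineq [of "gradient vp p" w]
      norm_triangle_ineq4 [of "gradient vm p" w] by auto
  ultimately show "norm (gradient vm p) \<le> (1 + b1 / b0) * ?S"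
    "norm (gradient vp p) \<le> (1 + b1 / b0) * ?S"
    using gS [OF p] wS unfolding distrib_right by auto
qed

section \<open>The trace estimate\<close>

theorem lemma3p5:
  fixes \<beta>m \<beta>p :: real
  assumes "\<beta>m > 0" and "\<beta>p > 0"
  shows "\<exists>C::real. \<forall>h \<Gamma> \<Omega> \<Omega>m \<Omega>p D E n a b nB vm vp.
    0 < h \<and> h < 1 \<and> interface_element h \<Gamma> \<Omega> \<Omega>m \<Omega>p D E n \<and>
    (a, b) \<in> edges h \<and> unit_normal a b nB \<and> bilinear_ife \<beta>m \<beta>p D E n vm vp \<longrightarrow>
    (let K = element h;
         \<beta> = coefficient h \<Omega>m \<beta>m \<beta>p;
         v_x = piecewise h D n (partial_x vm) (partial_x vp);
         v_y = piecewise h D n (partial_y vm) (partial_y vp);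
         grad_v = piecewise h D n (gradient vm) (gradient vp);
         R = C * h powr (1/2) * measure lborel K powr (-1/2)
               * L2_region K (\<lambda>p. sqrt (\<beta> p) *\<^sub>R grad_v p)
     in L2_segment a b (\<lambda>p. \<beta> p * v_x p) \<le> R \<and>
        L2_segment a b (\<lambda>p. \<beta> p * v_y p) \<le> R \<and>
        L2_segment a b (\<lambda>p. \<beta> p * (grad_v p \<bullet> nB)) \<le> R)"
proof -
  define b0 b1 where "b0 = min \<beta>m \<beta>p" and "b1 = max \<beta>m \<beta>p"
  have b: "0 < b0" "b0 \<le> \<beta>m" "\<beta>m \<le> b1" "b0 \<le> \<beta>p" "\<beta>p \<le> b1"
    using assms by (auto simp: b0_def b1_def)
  define C where "C = b1 * ((1 + b1 / b0) * (22 / sqrt b0))"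
  show ?thesis
  proof (intro exI [of _ C] allI impI, elim conjE, goal_cases)
    case (1 h \<Gamma> \<Omega> \<Omega>m \<Omega>p D E n a b nB vm vp)
    note h = 1(1) and K = 1(3) and ab = 1(4) and nB = 1(5) and ife = 1(6)
    let ?\<beta> = "coefficient h \<Omega>m \<beta>m \<beta>p"
    let ?g = "piecewise h D n (gradient vm) (gradient vp)"
    define T where "T = L2_region (element h) (\<lambda>p. sqrt (?\<beta> p) *\<^sub>R ?g p)"
    define G where "G = (1 + b1 / b0) * (22 / (h * sqrt b0) * T)"
    let ?R = "C * h powr (1/2) * measure lborel (element h) powr (-1/2) * T"
    have DE: "D \<in> element h" "E \<in> element h" "D \<noteq> E" "unit_normal D E n"
      using K frontier_subset_closed [of "element h"]
      by (auto simp: interface_element_def element_eq_cbox)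
    have G: "norm (?g p) \<le> G" if "p \<in> element h" for p
      using gradients_bounded_by_energy [OF h DE ife \<open>0 < b0\<close> b(2-5) that, of \<Omega>m]
      by (simp add: piecewise_def G_def T_def)
    have "a \<in> element h" "b \<in> element h" and len: "dist a b = h"
      using ab h by (auto simp: edges_def dist_Pair_Pair dist_real_def element_def)
    then have seg: "closed_segment a b \<subseteq> element h"
      by (intro closed_segment_subset) (auto simp: element_eq_cbox)
    have "measure lborel (element h) = h\<^sup>2"
      unfolding element_eq_cbox content_Pair using h by (simp add: power2_eq_square)
    then have "measure lborel (element h) powr (-1/2) = 1 / h"
      using h by (simp add: powr_minus_divide powr_half_sqrt)
    then have R: "?R = sqrt (dist a b) * (b1 * G)"
      using h by (simp add: len G_def C_def powr_half_sqrt mult_ac)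
    have edge: "L2_segment a b (\<lambda>p. ?\<beta> p * f p) \<le> ?R"
      if "\<And>p. \<bar>f p\<bar> \<le> norm (?g p)" for f
      unfolding R
    proof (rule L2_segment_le)
      fix p assume "p \<in> closed_segment a b"
      then have "\<bar>f p\<bar> \<le> G" using seg G that order_trans by blast
      moreover have "\<bar>?\<beta> p\<bar> \<le> b1" using assms b by (simp add: coefficient_def)
      ultimately show "norm (?\<beta> p * f p) \<le> b1 * G"
        by (simp add: abs_mult mult_mono)
    qed
    have x: "\<bar>piecewise h D n (partial_x vm) (partial_x vp) p\<bar> \<le> norm (?g p)"
      and y: "\<bar>piecewise h D n (partial_y vm) (partial_y vp) p\<bar> \<le> norm (?g p)" for p
      using norm_fst_le [of "fst (?g p)" "snd (?g p)"] norm_snd_le [of "snd (?g p)" "fst (?g p)"]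
      by (auto simp: piecewise_def gradient_def)
    have nrm: "\<bar>?g p \<bullet> nB\<bar> \<le> norm (?g p)" for p
      using Cauchy_Schwarz_ineq2 [of "?g p" nB] nB by (simp add: unit_normal_def)
    show ?case
      unfolding Let_def T_def [symmetric] using edge [OF x] edge [OF y] edge [OF nrm] by blast
  qed
qed

end
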